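(* Let $n$ be an odd positive integer with $n\notin\{5,9\}$. Below, the statement "the segment of $d$ is $[a,b]$" means that $a$ and $b$ are odd integers and the set of odd $d\in\{1,\dots,n\}$ satisfying the condition is exactly the set of odd integers in $[a,b]$; the length of the segment is $b-a$. (I) The value $h_{\min}(n)$ and the segment $\mathcal{D}_n$ of $d$ satisfying $h_{\min}(n,d)=h_{\min}(n)$ are as follows ($k$ denotes a positive integer): - if $n=8k-3$ or $n=8k-7$: $h_{\min}(n)=\frac{n+3}{4}$ and $\mathcal{D}_n=\left\{\frac{n+1}{2}\right\}$ (length $0$); - if $n=8k-1$: $h_{\min}(n)=\frac{n+5}{4}$ and $\mathcal{D}_n=\left[\frac{n+5}{4},\frac{n+3}{2}\right]$ (length $\frac{n+1}{4}$); - if $n=8k-5$: $h_{\min}(n)=\frac{n+5}{4}$ and $\mathcal{D}_n=\left[\frac{n+1}{4},\frac{n+3}{2}\right]$ (length $\frac{n+5}{4}$). (II) The segment of $d$ satisfying $h_{\min}(n,d)\le h_{\min}(n)+1$ is as follows ($l$ denotes a positive integer): - if $n=12l-3$: $\left[\frac{n+9}{6},\frac{n+5}{2}\right]$, of length $\frac{n+3}{3}$; - if $n=12l-7$: $\left[\frac{n+1}{6},\frac{n+5}{2}\right]$, of length $\frac{n+7}{3}$; - if $n=12l-11$: $\left[\frac{n+5}{6},\min\left\{\frac{n+5}{2},n\right\}\right]$, of length $\min\left\{\frac{n+5}{3},n-1\right\}$; - if $n=16l-1$: $\left[\frac{n+9}{8},\frac{n+7}{2}\right]$, of length $\frac{3n+19}{8}$;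 - if $n=16l-9$: $\left[\frac{n+1}{8},\frac{n+7}{2}\right]$, of length $\frac{3n+27}{8}$; - if $n=16l-5$: $\left[\frac{n+13}{8},\frac{n+7}{2}\right]$, of length $\frac{3n+15}{8}$; - if $n=16l-13$: $\left[\frac{n+5}{8},\min\left\{\frac{n+7}{2},n\right\}\right]$, of length $\min\left\{\frac{3n+23}{8},n-1\right\}$.
   Context: A graph with loops is a finite undirected graph $G=(V,E)$ without multiple edges in which every vertex $v$ has exactly one loop $(v,v)\in E$. The neighborhood of $v$ is $N_v=\{u\in V : (v,u)\in E\}$, so $v\in N_v$; the degree of $v$ is $|N_v|$ (the loop counts once). $G$ is $d$-regular if $|N_v|=d$ for every $v$. A configuration $G^f$ is a graph with loops $G$ together with an opinion function $f:V\to\{1,-1\}$; $v$ is happy if $f(v)=1$ and sad if $f(v)=-1$. A vertex $v$ is a proponent if $\sum_{u\in N_v}f(u)\ge 1$. $G^f$ with $|V|=n$ is approving if more than $n/2$ of its vertices are proponents. $\mathcal{G}_{n|d|h}$ is the class of all configurations $G^f$ such that $G$ is a $d$-regular graph with loops on $n$ vertices and exactly $h$ vertices are happy. For odd positive integers $d\le n$, $h_{\min}(n,d)$ is the minimum $h$ such that $\mathcal{G}_{n|d|h}$ contains an approving configuration, and $h_{\min}(n)=\min h_{\min}(n,d)$ over odd $d$ with $1\le d\le n$. (For odd $n$ only odd $d$ are considered, since $d$-regular graphs with loops on $n$ vertices exist only for odd $d$.) *)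

theory Defs
  imports Complex_Main
begin

text \<open>
  An undirected edge between distinct \<open>u\<close> and \<open>v\<close> is represented by the two pairs \<open>(u, v)\<close> and
  \<open>(v, u)\<close>; a loop is the single pair \<open>(v, v)\<close>, so it contributes one to the degree.
\<close>

definition graph_with_loops :: "'a set \<Rightarrow> 'a rel \<Rightarrow> bool" where
  "graph_with_loops V E \<longleftrightarrow>
     finite V \<and> E \<subseteq> V \<times> V \<and> sym E \<and> (\<forall>v\<in>V. (v, v) \<in> E)"

definition nbhd :: "'a set \<Rightarrow> 'a rel \<Rightarrow> 'a \<Rightarrow> 'a set" where
  "nbhd V E v = {u \<in> V. (v, u) \<in> E}"

definition regular :: "'a set \<Rightarrow> 'a rel \<Rightarrow> nat \<Rightarrow> bool" where
  "regular V E d \<longleftrightarrow> (\<forall>v\<in>V. card (nbhd V E v) = d)"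

text \<open>The values of an opinion function outside \<open>V\<close> are irrelevant and left unconstrained.\<close>

definition opinion_function :: "'a set \<Rightarrow> ('a \<Rightarrow> int) \<Rightarrow> bool" where
  "opinion_function V f \<longleftrightarrow> (\<forall>v\<in>V. f v \<in> {1, -1})"

type_synonym 'a configuration = "'a set \<times> 'a rel \<times> ('a \<Rightarrow> int)"

definition happy :: "('a \<Rightarrow> int) \<Rightarrow> 'a \<Rightarrow> bool" where
  "happy f v \<longleftrightarrow> f v = 1"

definition proponent :: "'a set \<Rightarrow> 'a rel \<Rightarrow> ('a \<Rightarrow> int) \<Rightarrow> 'a \<Rightarrow> bool" where
  "proponent V E f v \<longleftrightarrow> (\<Sum>u\<in>nbhd V E v. f u) \<ge> 1"

definition approving :: "'a set \<Rightarrow> 'a rel \<Rightarrow> ('a \<Rightarrow> int) \<Rightarrow> bool" where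
  "approving V E f \<longleftrightarrow> real (card {v \<in> V. proponent V E f v}) > real (card V) / 2"

definition config_class :: "nat \<Rightarrow> nat \<Rightarrow> nat \<Rightarrow> 'a configuration set" where
  "config_class n d h =
     {(V, E, f). graph_with_loops V E \<and> opinion_function V f \<and>
        card V = n \<and> regular V E d \<and> card {v \<in> V. happy f v} = h}"

text \<open>
  The vertices are taken to be natural numbers, which loses no generality because every finite
  graph is isomorphic to one of this kind. For odd \<open>d \<le> n\<close> with \<open>n\<close> odd the minimum is attained:
  a \<open>d\<close>-regular circulant graph with loops in which everybody is happy is approving.
\<close>

definition h_min_deg :: "nat \<Rightarrow> nat \<Rightarrow> nat" where
  "h_min_deg n d =
     (LEAST h. \<exists>(V, E, f) \<in> (config_class n d h :: nat configuration set). approving V E f)"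

definition odd_degrees :: "nat \<Rightarrow> nat set" where
  "odd_degrees n = {d \<in> {1..n}. odd d}"

definition h_min :: "nat \<Rightarrow> nat" where
  "h_min n = Min (h_min_deg n ` odd_degrees n)"

definition optimal_degrees :: "nat \<Rightarrow> nat set" where
  "optimal_degrees n = {d \<in> odd_degrees n. h_min_deg n d = h_min n}"

definition near_optimal_degrees :: "nat \<Rightarrow> nat set" where
  "near_optimal_degrees n = {d \<in> odd_degrees n. h_min_deg n d \<le> h_min n + 1}"

text \<open>
  \<open>is_segment D a b len\<close>: the segment of the set \<open>D\<close> of degrees is \<open>[a, b]\<close>, and it has length
  \<open>len\<close>. The end points are real so that fractions such as \<open>(n + 5) / 4\<close> are not rounded; that
  they are odd integers is part of the condition.
\<close>

definition is_segment :: "nat set \<Rightarrow> real \<Rightarrow> real \<Rightarrow> real \<Rightarrow> bool" where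
  "is_segment D a b len \<longleftrightarrow>
     (\<exists>a' b' :: int. a = of_int a' \<and> b = of_int b' \<and> odd a' \<and> odd b' \<and>
        int ` D = {x. odd x \<and> a' \<le> x \<and> x \<le> b'}) \<and>
     len = b - a"

end

theory Submission
  imports Defs "HOL-Library.Nat_Bijection"
begin

text \<open>
  Write \<open>n = 2m - 1\<close> and \<open>d = 2c - 1\<close>. A vertex is a proponent iff it has at least \<open>c\<close> happy
  neighbours, so counting the edges between proponents and happy vertices gives \<open>c \<le> h\<close> and
  \<open>m c \<le> h d\<close> whenever \<open>h\<close> happy vertices suffice. For \<open>n \<notin> {5, 9}\<close> these two conditions are
  also sufficient. To see this, cut the vertex set into three blocks, the first of which is the set of
  happy vertices, and prescribe the number of edges between any two blocks. A graph with these
  numbers exists, and switching an edge \<open>xy\<close> to \<open>x'y\<close> with \<open>x, x'\<close> in the same block does not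
  change them; so both the degrees and the numbers of happy neighbours can be made almost constant on
  every block. Hence it is enough to choose the numbers so that their averages are right.
  With \<open>2h = m + e\<close> the second condition says \<open>h \<le> e c\<close>, which yields \<open>h_min n = m div 2 + 1\<close>
  and all segments.
\<close>

section \<open>Switchings\<close>

definition switch :: "'a \<Rightarrow> 'a \<Rightarrow> 'a \<Rightarrow> 'a rel \<Rightarrow> 'a rel" where
  "switch x x' y E = (E - {(x, y), (y, x)}) \<union> {(x', y), (y, x')}"

lemma graph_with_loops_switch:
  assumes "graph_with_loops V E" "x' \<in> V" "y \<in> V" "y \<noteq> x"
  shows "graph_with_loops V (switch x x' y E)"
  using assms unfolding graph_with_loops_def switch_def sym_def by blast

text \<open>\<open>y\<close> exchanges its neighbour \<open>x\<close> for \<open>x'\<close>, which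
  \<open>Z\<close> cannot tell apart; so only \<open>x\<close> and \<open>x'\<close> are affected,
  and only if \<open>y\<close> lies in \<open>Z\<close>.\<close>

lemma card_nbhd_switch:
  assumes g: "graph_with_loops V E" and V: "x \<in> V" "x' \<in> V" "y \<in> V"
    and xy: "(x, y) \<in> E" "(x', y) \<notin> E" "y \<noteq> x"
    and Z: "finite Z" "x \<in> Z \<longleftrightarrow> x' \<in> Z"
  shows "int (card (nbhd Z (switch x x' y E) v)) =
     int (card (nbhd Z E v)) +
     (if y \<in> Z then (if v = x' then 1 else 0) - (if v = x then 1 else 0) else 0)"
proof -
  have sym: "sym E" and loop: "(x', x') \<in> E" using g V unfolding graph_with_loops_def by auto
  have yx': "y \<noteq> x'" "x \<noteq> x'" using xy loop by auto
  have yx: "(y, x) \<in> E" "(y, x') \<notin> E" using sym xy by (auto dest: symD)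
  have fin: "finite (nbhd Z F u)" for F u using Z(1) by (auto simp: nbhd_def)
  consider "v = x" | "v = x'" | "v = y" | "v \<noteq> x" "v \<noteq> x'" "v \<noteq> y" by blast
  then show ?thesis
  proof cases
    case 1
    have "nbhd Z (switch x x' y E) x = nbhd Z E x - {y}"
      using yx' xy by (auto simp: nbhd_def switch_def)
    moreover have "card (nbhd Z E x) = Suc (card (nbhd Z E x - {y}))" if "y \<in> Z"
      using that xy fin by (intro card.remove) (auto simp: nbhd_def)
    moreover have "nbhd Z E x - {y} = nbhd Z E x" if "y \<notin> Z"
      using that by (auto simp: nbhd_def)
    ultimately show ?thesis using 1 yx' by auto
  next
    case 2
    have "nbhd Z (switch x x' y E) x' = (if y \<in> Z then insert y (nbhd Z E x') else nbhd Z E x')"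
      using yx' xy by (auto simp: nbhd_def switch_def)
    moreover have "y \<notin> nbhd Z E x'" using xy by (auto simp: nbhd_def)
    ultimately show ?thesis using 2 yx' fin by auto
  next
    case 3
    have eq: "nbhd Z (switch x x' y E) y
        = (if x \<in> Z then insert x' (nbhd Z E y - {x}) else nbhd Z E y)"
      using yx' xy yx Z by (auto simp: nbhd_def switch_def)
    have "card (insert x' (nbhd Z E y - {x})) = card (nbhd Z E y)" if "x \<in> Z"
    proof -
      have "x' \<notin> nbhd Z E y" "x \<in> nbhd Z E y" using yx that by (auto simp: nbhd_def)
      then show ?thesis using fin card.remove[OF fin, of x] by (metis DiffD1 card_insert_disjoint finite_Diff)
    qed
    then show ?thesis using 3 yx' xy eq by auto
  next
    case 4
    have "nbhd Z (switch x x' y E) v = nbhd Z E v"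
      using 4 by (auto simp: nbhd_def switch_def)
    then show ?thesis using 4 by simp
  qed
qed

text \<open>If \<open>x \<in> Z\<close> is not adjacent to \<open>x'\<close>, then \<open>x'\<close> is a neighbour of \<open>x'\<close> but not of \<open>x\<close>; so \<open>x\<close> has at
  least two neighbours that \<open>x'\<close> lacks, one of them different from \<open>x\<close> itself.\<close>

lemma obtain_switch:
  assumes g: "graph_with_loops V E" and V: "x \<in> V" "x' \<in> V" "Z \<subseteq> V" "x \<in> Z \<longleftrightarrow> x' \<in> Z"
    and lt: "card (nbhd Z E x') < card (nbhd Z E x)"
  obtains y where "y \<in> Z" "(x, y) \<in> E" "(x', y) \<notin> E" "y \<noteq> x"
proof -
  have sym: "sym E" and loop: "(x', x') \<in> E" "(x, x) \<in> E" and fV: "finite V"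
    using g V unfolding graph_with_loops_def by auto
  have fin: "finite (nbhd Z E u)" for u
    using finite_subset[OF V(3) fV] by (auto simp: nbhd_def)
  have "\<not> nbhd Z E x - {x} \<subseteq> nbhd Z E x'"
  proof
    assume sub: "nbhd Z E x - {x} \<subseteq> nbhd Z E x'"
    show False
    proof (cases "x \<in> Z \<and> (x', x) \<notin> E")
      case True
      then have "(x, x') \<notin> E" using sym by (auto dest: symD)
      then have "insert x' (nbhd Z E x - {x}) \<subseteq> nbhd Z E x'" "x' \<notin> nbhd Z E x" "x \<in> nbhd Z E x"
        using True V loop sub by (auto simp: nbhd_def)
      moreover from this have "card (insert x' (nbhd Z E x - {x})) = card (nbhd Z E x)"
        using card.remove[OF fin, of x x] fin[of x] by simp
      ultimately have "card (nbhd Z E x) \<le> card (nbhd Z E x')"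
        using card_mono[OF fin] by metis
      then show False using lt by simp
    next
      case False
      then have "nbhd Z E x \<subseteq> nbhd Z E x'" using sub by (auto simp: nbhd_def)
      then show False using card_mono[OF fin] lt by (simp add: leD)
    qed
  qed
  then show ?thesis using that by (auto simp: nbhd_def)
qed

text \<open>Ordered pairs are counted: inside one block an ordinary edge counts twice and a loop
  once. This is the source of the later parity conditions.\<close>

lemma sum_card_nbhd:
  assumes "finite U" "finite Z"
  shows "(\<Sum>v\<in>U. card (nbhd Z E v)) = card (E \<inter> U \<times> Z)"
proof -
  have "E \<inter> U \<times> Z = Sigma U (nbhd Z E)" by (auto simp: nbhd_def)
  then show ?thesis using assms by (simp add: nbhd_def)
qed

lemma sum_card_nbhd_sym:
  assumes "finite U" "finite Z" "sym E"
  shows "(\<Sum>v\<in>U. card (nbhd Z E v)) = (\<Sum>v\<in>Z. card (nbhd U E v))"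
proof -
  have "E \<inter> Z \<times> U = (E \<inter> U \<times> Z)\<inverse>" using assms(3) by (auto dest: symD)
  then show ?thesis using assms by (simp add: sum_card_nbhd)
qed

text \<open>The gain at \<open>x'\<close> and the loss at \<open>x\<close> cancel in the sum over
  \<open>U\<close>, which contains both or neither.\<close>

lemma card_block_switch:
  assumes g: "graph_with_loops V E" and V: "x \<in> V" "x' \<in> V" "y \<in> V"
    and xy: "(x, y) \<in> E" "(x', y) \<notin> E" "y \<noteq> x"
    and U: "finite U" "x \<in> U \<longleftrightarrow> x' \<in> U" and Z: "finite Z" "x \<in> Z \<longleftrightarrow> x' \<in> Z"
  shows "card (switch x x' y E \<inter> U \<times> Z) = card (E \<inter> U \<times> Z)"
proof -
  have "int (\<Sum>v\<in>U. card (nbhd Z (switch x x' y E) v)) = int (\<Sum>v\<in>U. card (nbhd Z E v))"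
    using U by (cases "y \<in> Z"; cases "x' \<in> U")
      (simp_all add: card_nbhd_switch[OF g V xy Z] sum.distrib sum_subtractf)
  then show ?thesis by (simp add: sum_card_nbhd U Z)
qed

text \<open>One value below \<open>c\<close> would force all values to be at most \<open>c\<close>,
  and the sum would fall short.\<close>

lemma near_constant_ge:
  fixes f :: "'a \<Rightarrow> nat"
  assumes "finite U" "\<And>x y. x \<in> U \<Longrightarrow> y \<in> U \<Longrightarrow> f x \<le> f y + 1"
    and sum: "c * card U \<le> sum f U" and "x \<in> U"
  shows "c \<le> f x"
proof (rule ccontr)
  assume "\<not> c \<le> f x"
  then have "sum f U < (\<Sum>y\<in>U. c)"
    using assms by (intro sum_strict_mono_ex1) (fastforce simp: not_le)+
  then show False using sum by (simp add: mult.commute)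
qed

lemma near_constant_le:
  fixes f :: "'a \<Rightarrow> nat"
  assumes "finite U" "\<And>x y. x \<in> U \<Longrightarrow> y \<in> U \<Longrightarrow> f x \<le> f y + 1"
    and sum: "sum f U \<le> c * card U" and "x \<in> U"
  shows "f x \<le> c"
proof (rule ccontr)
  assume "\<not> f x \<le> c"
  then have "(\<Sum>y\<in>U. c) < sum f U"
    using assms by (intro sum_strict_mono_ex1) (fastforce simp: not_le)+
  then show False using sum by (simp add: mult.commute)
qed

section \<open>Equalising degrees inside the blocks\<close>

definition block :: "'a set \<Rightarrow> ('a \<Rightarrow> nat) \<Rightarrow> nat \<Rightarrow> 'a set" where
  "block V cls i = {v \<in> V. cls v = i}"

lemma sum_remove2:
  assumes "finite V" "x \<in> V" "x' \<in> V" "x \<noteq> x'"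
  shows "sum f V = f x + f x' + sum f (V - {x, x'})"
proof -
  have "V - {x, x'} = V - {x} - {x'}" by auto
  then show ?thesis
    using assms sum.remove[of V x f] sum.remove[of "V - {x}" x' f] by (simp add: add.assoc)
qed

text \<open>In the next two lemmas \<open>a\<close> counts the neighbours in block 0 and \<open>b\<close> the other ones. The third
  square makes the total degrees differ by at most 1, which the first two alone would not ensure.\<close>

lemma switch_potential_decreases:
  fixes a b a' b' :: int
  assumes "2 * (a - a') + (a + b - (a' + b')) > 3"
  shows "2 * (a - 1)\<^sup>2 + 2 * b\<^sup>2 + (a - 1 + b)\<^sup>2 + (2 * (a' + 1)\<^sup>2 + 2 * b'\<^sup>2 + (a' + 1 + b')\<^sup>2)
      < 2 * a\<^sup>2 + 2 * b\<^sup>2 + (a + b)\<^sup>2 + (2 * a'\<^sup>2 + 2 * b'\<^sup>2 + (a' + b')\<^sup>2)"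
  using assms by (simp add: power2_eq_square algebra_simps)

lemma ex_equalized_graph:
  fixes V :: "'a set"
  assumes "graph_with_loops V E0"
  obtains E where "graph_with_loops V E"
    "\<And>i j. card (E \<inter> block V cls i \<times> block V cls j) = card (E0 \<inter> block V cls i \<times> block V cls j)"
    "\<And>x x'. x \<in> V \<Longrightarrow> x' \<in> V \<Longrightarrow> cls x = cls x' \<Longrightarrow> card (nbhd V E x) \<le> card (nbhd V E x') + 1"
    "\<And>x x'. x \<in> V \<Longrightarrow> x' \<in> V \<Longrightarrow> cls x = cls x' \<Longrightarrow>
       card (nbhd (block V cls 0) E x) \<le> card (nbhd (block V cls 0) E x') + 1"
proof -
  define B where "B = block V cls"
  define S where "S = V - B 0"
  define a where "a E v = int (card (nbhd (B 0) E v))" for E v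
  define b where "b E v = int (card (nbhd S E v))" for E v
  define \<phi> where "\<phi> E v = 2 * (a E v)\<^sup>2 + 2 * (b E v)\<^sup>2 + (a E v + b E v)\<^sup>2" for E v
  define ok where "ok E \<longleftrightarrow> graph_with_loops V E \<and> (\<forall>i j. card (E \<inter> B i \<times> B j) = card (E0 \<inter> B i \<times> B j))" for E
  have fin: "finite V" "finite (B i)" "finite S" for i
    using assms by (auto simp: graph_with_loops_def B_def S_def block_def)
  have sub: "B i \<subseteq> V" "S \<subseteq> V" for i by (auto simp: B_def S_def block_def)
  have "ok E0" using assms by (simp add: ok_def)
  \<comment> \<open>\<open>E\<close> minimises the potential among all graphs with the block counts
    of \<open>E0\<close>.\<close>
  from ex_has_least_nat[of ok E0 "\<lambda>E. nat (\<Sum>v\<in>V. \<phi> E v)", OF this]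
  obtain E where E: "ok E" and least: "\<And>F. ok F \<Longrightarrow> nat (\<Sum>v\<in>V. \<phi> E v) \<le> nat (\<Sum>v\<in>V. \<phi> F v)" by blast
  have \<phi>_nonneg: "0 \<le> (\<Sum>v\<in>V. \<phi> F v)" for F by (intro sum_nonneg) (simp add: \<phi>_def)
  have least': "(\<Sum>v\<in>V. \<phi> E v) \<le> (\<Sum>v\<in>V. \<phi> F v)" if "ok F" for F
    using least[OF that] \<phi>_nonneg[of F] by simp
  have g: "graph_with_loops V E" using E by (simp add: ok_def)
  \<comment> \<open>If \<open>x\<close> has more neighbours in \<open>Z\<close> than
    \<open>x'\<close>, it can pass one on to \<open>x'\<close> with all block counts kept.\<close>
  have sw: "\<exists>F y. ok F \<and> y \<in> Z \<and> x \<noteq> x' \<and> (\<forall>Y v. Y \<in> {B 0, S} \<longrightarrow> int (card (nbhd Y F v)) = int (card (nbhd Y E v)) +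
       (if y \<in> Y then (if v = x' then 1 else 0) - (if v = x then 1 else 0) else 0))"
    if x: "x \<in> V" "x' \<in> V" "cls x = cls x'" and Z: "Z \<in> {B 0, S}"
      and lt: "card (nbhd Z E x') < card (nbhd Z E x)" for x x' Z
  proof -
    have mem: "x \<in> B i \<longleftrightarrow> x' \<in> B i" "x \<in> S \<longleftrightarrow> x' \<in> S" for i
      using x by (auto simp: B_def S_def block_def)
    have "Z \<subseteq> V" "x \<in> Z \<longleftrightarrow> x' \<in> Z" using Z mem sub by auto
    from obtain_switch[OF g x(1,2) this lt] obtain y where y: "y \<in> Z" "(x, y) \<in> E" "(x', y) \<notin> E" "y \<noteq> x" .
    have yV: "y \<in> V" using y \<open>Z \<subseteq> V\<close> by auto
    have "ok (switch x x' y E)"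
      using E graph_with_loops_switch[OF g x(2) yV y(4)] card_block_switch[OF g x(1,2) yV y(2-4)] fin mem
      by (simp add: ok_def)
    moreover have "\<forall>Y v. Y \<in> {B 0, S} \<longrightarrow> int (card (nbhd Y (switch x x' y E) v)) = int (card (nbhd Y E v)) +
       (if y \<in> Y then (if v = x' then 1 else 0) - (if v = x then 1 else 0) else 0)"
      using card_nbhd_switch[OF g x(1,2) yV y(2-4)] fin mem by blast
    ultimately show ?thesis using y lt by blast
  qed
  \<comment> \<open>Otherwise a switch with \<open>y\<close> in block 0 would lower the potential at
    \<open>x\<close> and \<open>x'\<close> and keep it elsewhere.\<close>
  have aE: "2 * (a E x - a E x') + (a E x + b E x - (a E x' + b E x')) \<le> 3"
    if x: "x \<in> V" "x' \<in> V" "cls x = cls x'" and lt: "a E x' < a E x" for x x'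
  proof (rule ccontr)
    assume *: "\<not> ?thesis"
    obtain F y where F: "ok F" "y \<in> B 0" "x \<noteq> x'" and ch: "\<forall>Y v. Y \<in> {B 0, S} \<longrightarrow> int (card (nbhd Y F v)) = int (card (nbhd Y E v)) +
       (if y \<in> Y then (if v = x' then 1 else 0) - (if v = x then 1 else 0) else 0)"
      using sw[of x x' "B 0"] x lt by (auto simp: a_def)
    have "y \<notin> S" using F by (simp add: S_def)
    then have ab: "a F v = a E v + (if v = x' then 1 else 0) - (if v = x then 1 else 0)" "b F v = b E v" for v
      using ch F(2) by (auto simp: a_def b_def)
    have "\<phi> F x + \<phi> F x' < \<phi> E x + \<phi> E x'"
      using switch_potential_decreases[of "a E x" "a E x'" "b E x" "b E x'"] * F(3)
      by (simp add: \<phi>_def ab)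
    moreover have "(\<Sum>v\<in>V - {x, x'}. \<phi> F v) = (\<Sum>v\<in>V - {x, x'}. \<phi> E v)"
      by (intro sum.cong) (auto simp: \<phi>_def ab)
    ultimately show False
      using least'[OF F(1)] sum_remove2[OF fin(1) x(1,2) F(3), of "\<phi> E"] sum_remove2[OF fin(1) x(1,2) F(3), of "\<phi> F"]
      by linarith
  qed
  have bE: "2 * (b E x - b E x') + (a E x + b E x - (a E x' + b E x')) \<le> 3"
    if x: "x \<in> V" "x' \<in> V" "cls x = cls x'" and lt: "b E x' < b E x" for x x'
  proof (rule ccontr)
    assume *: "\<not> ?thesis"
    obtain F y where F: "ok F" "y \<in> S" "x \<noteq> x'" and ch: "\<forall>Y v. Y \<in> {B 0, S} \<longrightarrow> int (card (nbhd Y F v)) = int (card (nbhd Y E v)) +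
       (if y \<in> Y then (if v = x' then 1 else 0) - (if v = x then 1 else 0) else 0)"
      using sw[of x x' S] x lt by (auto simp: b_def)
    have "y \<notin> B 0" using F by (simp add: S_def)
    then have ab: "b F v = b E v + (if v = x' then 1 else 0) - (if v = x then 1 else 0)" "a F v = a E v" for v
      using ch F(2) by (auto simp: a_def b_def)
    have "\<phi> F x + \<phi> F x' < \<phi> E x + \<phi> E x'"
      using switch_potential_decreases[of "b E x" "b E x'" "a E x" "a E x'"] * F(3)
      by (simp add: \<phi>_def ab algebra_simps)
    moreover have "(\<Sum>v\<in>V - {x, x'}. \<phi> F v) = (\<Sum>v\<in>V - {x, x'}. \<phi> E v)"
      by (intro sum.cong) (auto simp: \<phi>_def ab)
    ultimately show False
      using least'[OF F(1)] sum_remove2[OF fin(1) x(1,2) F(3), of "\<phi> E"] sum_remove2[OF fin(1) x(1,2) F(3), of "\<phi> F"]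
      by linarith
  qed
  have deg: "int (card (nbhd V E v)) = a E v + b E v" for v
  proof -
    have "nbhd V E v = nbhd (B 0) E v \<union> nbhd S E v" "nbhd (B 0) E v \<inter> nbhd S E v = {}"
      using sub by (auto simp: nbhd_def S_def)
    then show ?thesis using fin by (simp add: a_def b_def card_Un_disjoint nbhd_def)
  qed
  \<comment> \<open>If both parts are larger at \<open>x\<close>, the doubled difference uses up at
    least 2 of the bound 3. If only one is, its difference is at least that of the totals, so three
    times the latter is at most 3.\<close>
  have tot: "a E x + b E x \<le> a E x' + b E x' + 1" if x: "x \<in> V" "x' \<in> V" "cls x = cls x'" for x x'
    using aE[OF x] bE[OF x] by (cases "a E x' < a E x"; cases "b E x' < b E x") simp_all
  \<comment> \<open>An excess of 2 or more in \<open>a\<close> would make the total smaller by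
    exactly 1 and hence \<open>b\<close> smaller by at least 3, which \<open>bE\<close> with
    \<open>x\<close> and \<open>x'\<close> exchanged excludes.\<close>
  have aa: "a E x \<le> a E x' + 1" if x: "x \<in> V" "x' \<in> V" "cls x = cls x'" for x x'
    using aE[OF x] bE[OF x(2,1) x(3)[symmetric]] tot[OF x] tot[OF x(2,1) x(3)[symmetric]]
    by (cases "a E x' < a E x"; cases "b E x < b E x'") simp_all
  show ?thesis
  proof (rule that[OF g])
    show "card (E \<inter> block V cls i \<times> block V cls j) = card (E0 \<inter> block V cls i \<times> block V cls j)" for i j
      using E by (simp add: ok_def B_def)
    show "card (nbhd V E x) \<le> card (nbhd V E x') + 1" if "x \<in> V" "x' \<in> V" "cls x = cls x'" for x x'
      using tot[OF that] deg[of x] deg[of x'] by linarith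
    show "card (nbhd (block V cls 0) E x) \<le> card (nbhd (block V cls 0) E x') + 1" if "x \<in> V" "x' \<in> V" "cls x = cls x'" for x x'
      using aa[OF that] by (simp add: a_def B_def)
  qed
qed

section \<open>Graphs with prescribed edge numbers between blocks\<close>

lemma card_Id_on: "card (Id_on U) = card U"
proof -
  have "Id_on U = (\<lambda>x. (x, x)) ` U" by auto
  then show ?thesis by (simp add: card_image inj_on_def)
qed

lemma card_less_pairs:
  fixes U :: "'a :: linorder set"
  assumes "finite U"
  shows "2 * card {(u, v) \<in> U \<times> U. u < v} + card U = card U * card U"
proof -
  define L where "L = {(u, v) \<in> U \<times> U. u < v}"
  have fin: "finite L" using assms by (auto simp: L_def intro: finite_subset[of _ "U \<times> U"])
  have "U \<times> U = (L \<union> L\<inverse>) \<union> Id_on U" by (auto simp: L_def Id_on_def)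
  then have "card (U \<times> U) = card ((L \<union> L\<inverse>) \<union> Id_on U)" by (rule arg_cong)
  also have "\<dots> = card (L \<union> L\<inverse>) + card (Id_on U)"
    using fin assms by (intro card_Un_disjoint) (auto simp: Id_on_def L_def)
  also have "card (L \<union> L\<inverse>) = card L + card (L\<inverse>)"
    using fin by (intro card_Un_disjoint) (auto simp: L_def)
  finally show ?thesis by (simp add: card_Id_on card_cartesian_product L_def)
qed

text \<open>Between two blocks any \<open>e i j\<close> pairs will do. Inside a block
  \<open>t i\<close> edges are picked, each counted in both orientations, and the loops contribute
  the size of the block.\<close>

lemma ex_block_graph:
  fixes V :: "'a :: linorder set"
  assumes fin: "finite V"
    and sym: "\<And>i j. e i j = e j i"
    and off: "\<And>i j. i \<noteq> j \<Longrightarrow> e i j \<le> card (block V cls i) * card (block V cls j)"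
    and diag: "\<And>i. e i i = card (block V cls i) + 2 * t i"
      "\<And>i. e i i \<le> card (block V cls i) * card (block V cls i)"
  obtains E where "graph_with_loops V E" "\<And>i j. card (E \<inter> block V cls i \<times> block V cls j) = e i j"
proof -
  define B where "B = block V cls"
  have finB: "finite (B i)" for i using fin by (simp add: B_def block_def)
  \<comment> \<open>The linear order selects one orientation of each possible edge inside a
    block.\<close>
  define R where "R i j = (if i = j then {(u, v) \<in> B i \<times> B i. u < v} else B i \<times> B j)" for i j :: nat
  have finR: "finite (R i j)" for i j
    using finB by (auto simp: R_def intro: finite_subset[of _ "B i \<times> B i"])
  have "\<exists>T. T \<subseteq> R i j \<and> card T = (if i = j then t i else e i j)" for i j
  proof -
    have "t i \<le> card {(u, v) \<in> B i \<times> B i. u < v}"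
      using diag[of i] card_less_pairs[OF finB[of i]] by (simp add: B_def)
    then have "(if i = j then t i else e i j) \<le> card (R i j)"
      using off[of i j] by (auto simp: R_def B_def card_cartesian_product)
    then show ?thesis by (metis obtain_subset_with_card_n)
  qed
  then obtain T where T: "\<And>i j. T i j \<subseteq> R i j" "\<And>i j. card (T i j) = (if i = j then t i else e i j)"
    by metis
  \<comment> \<open>\<open>T i j\<close> and \<open>T j i\<close> are chosen independently, so only
    the one with \<open>i \<le> j\<close> is used, together with its mirror image.\<close>
  define E where "E = {(u, v). u \<in> V \<and> v \<in> V \<and>
     (u = v \<or> cls u \<le> cls v \<and> (u, v) \<in> T (cls u) (cls v) \<or> cls v \<le> cls u \<and> (v, u) \<in> T (cls v) (cls u))}"
  have g: "graph_with_loops V E"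
    using fin by (auto simp: graph_with_loops_def E_def sym_def)
  have TB: "T i j \<subseteq> B i \<times> B j" for i j using T(1)[of i j] by (auto simp: R_def split: if_splits)
  have Tcls: "u \<in> V \<and> v \<in> V \<and> cls u = i \<and> cls v = j" if "(u, v) \<in> T i j" for u v i j
    using TB[of i j] that by (auto simp: B_def block_def)
  have finT: "finite (T i j)" for i j using finite_subset[OF T(1) finR] .
  have less: "card (E \<inter> B i \<times> B j) = e i j" if "i < j" for i j
  proof -
    have "E \<inter> B i \<times> B j = T i j"
      using that Tcls by (fastforce simp: E_def B_def block_def)
    then show ?thesis using that T(2) by simp
  qed
  have greater: "card (E \<inter> B i \<times> B j) = e i j" if "j < i" for i j
  proof -
    have "E \<inter> B i \<times> B j = (E \<inter> B j \<times> B i)\<inverse>"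
      using g by (auto simp: graph_with_loops_def sym_def)
    then show ?thesis using less[OF that] sym[of i j] by simp
  qed
  have eq: "card (E \<inter> B i \<times> B i) = e i i" for i
  proof -
    have lt: "u < v" if "(u, v) \<in> T i i" for u v using T(1)[of i i] that by (auto simp: R_def)
    have "E \<inter> B i \<times> B i = (T i i \<union> (T i i)\<inverse>) \<union> Id_on (B i)"
      using Tcls by (fastforce simp: E_def B_def block_def)
    moreover have "card ((T i i \<union> (T i i)\<inverse>) \<union> Id_on (B i)) = card (T i i \<union> (T i i)\<inverse>) + card (Id_on (B i))"
      using finT finB by (intro card_Un_disjoint) (auto simp: Id_on_def dest: lt)
    moreover have "T i i \<inter> (T i i)\<inverse> = {}" using lt less_asym by blast
    then have "card (T i i \<union> (T i i)\<inverse>) = card (T i i) + card ((T i i)\<inverse>)"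
      using finT by (intro card_Un_disjoint) auto
    ultimately show ?thesis using card_Id_on[of "B i"] T(2)[of i i] diag(1)[of i] by (simp add: B_def)
  qed
  show ?thesis
  proof (rule that[OF g])
    fix i j show "card (E \<inter> block V cls i \<times> block V cls j) = e i j"
      using less[of i j] greater[of j i] eq[of i] by (cases i j rule: linorder_cases) (auto simp: B_def)
  qed
qed

text \<open>A vertex is the code of a pair of block index and position, since configurations live on
  \<open>nat\<close>.\<close>

lemma ex_blocks:
  fixes s :: "nat \<Rightarrow> nat"
  obtains V :: "nat set" and cls where "finite V" "\<And>v. v \<in> V \<Longrightarrow> cls v < k"
    "\<And>i. card (block V cls i) = (if i < k then s i else 0)"
proof -
  define V where "V = prod_encode ` (SIGMA i:{..<k}. {..<s i})"
  define cls where "cls v = fst (prod_decode v)" for v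
  have "block V cls i = prod_encode ` ({i} \<times> {..<s i})" if "i < k" for i
    using that by (auto simp: block_def V_def cls_def)
  moreover have "block V cls i = {}" if "\<not> i < k" for i
    using that by (auto simp: block_def V_def cls_def)
  moreover have "card (prod_encode ` ({i} \<times> {..<s i})) = s i" for i
    by (subst card_image) (auto simp: card_cartesian_product intro: inj_onI)
  ultimately have "card (block V cls i) = (if i < k then s i else 0)" for i by simp
  then show ?thesis by (intro that[of V cls]) (auto simp: V_def cls_def)
qed

section \<open>Approving configurations\<close>

lemma sum_opinions:
  assumes "finite U" "\<And>u. u \<in> U \<Longrightarrow> f u \<in> {1, -1 :: int}"
  shows "(\<Sum>u\<in>U. f u) = 2 * int (card {u \<in> U. happy f u}) - int (card U)"
proof -
  have "(\<Sum>u\<in>U. f u) = (\<Sum>u\<in>U. 2 * (if happy f u then 1 else 0) - 1)"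
    using assms(2) by (intro sum.cong) (auto simp: happy_def)
  also have "\<dots> = 2 * (\<Sum>u\<in>U. if happy f u then 1 else 0) - int (card U)"
    by (simp add: sum_subtractf sum_distrib_left)
  also have "(\<Sum>u\<in>U. if happy f u then 1 else 0) = int (card {u \<in> U. happy f u})"
    using assms(1) by (simp add: sum.If_cases Int_def)
  finally show ?thesis .
qed

text \<open>With \<open>k\<close> happy neighbours the opinions around \<open>v\<close> add up to
  \<open>2 * k - (2 * c - 1)\<close>, which is positive iff \<open>c \<le> k\<close>.\<close>

lemma proponent_iff:
  assumes "finite V" "opinion_function V f" "card (nbhd V E v) + 1 = 2 * c"
  shows "proponent V E f v \<longleftrightarrow> c \<le> card (nbhd {u \<in> V. happy f u} E v)"
proof -
  have "{u \<in> nbhd V E v. happy f u} = nbhd {u \<in> V. happy f u} E v"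
    by (auto simp: nbhd_def)
  then have "(\<Sum>u\<in>nbhd V E v. f u) =
      2 * int (card (nbhd {u \<in> V. happy f u} E v)) - int (card (nbhd V E v))"
    using sum_opinions[of "nbhd V E v" f] assms(1,2)
    by (simp add: nbhd_def opinion_function_def)
  then show ?thesis using assms(3) by (auto simp: proponent_def)
qed

text \<open>At least \<open>m\<close> proponents each see at least \<open>c\<close> happy vertices,
  while the happy vertices are seen \<open>h * d\<close> times in all.\<close>

lemma approving_config_lower_bound:
  assumes conf: "(V, E, f) \<in> config_class n d h" and app: "approving V E f"
    and n: "n + 1 = 2 * m" and d: "d + 1 = 2 * c"
  shows "c \<le> h" "m * c \<le> h * d"
proof -
  let ?H = "{v \<in> V. happy f v}" and ?P = "{v \<in> V. proponent V E f v}"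
  have V: "finite V" "sym E" "opinion_function V f" "card V = n" "card ?H = h"
    using conf by (auto simp: config_class_def graph_with_loops_def)
  have reg: "card (nbhd V E v) = d" if "v \<in> V" for v
    using conf that by (auto simp: config_class_def graph_with_loops_def regular_def)
  have H: "c \<le> card (nbhd ?H E v)" if "v \<in> ?P" for v
    using proponent_iff[OF V(1,3), of E v c] reg[of v] d that by simp
  have "real n < 2 * real (card ?P)" using app V(4) by (simp add: approving_def)
  then have mP: "m \<le> card ?P" using n by linarith
  have "0 < m" using n by presburger
  then have "?P \<noteq> {}" using mP by force
  then obtain v where "v \<in> ?P" by blast
  moreover have "card (nbhd ?H E v) \<le> card ?H"
    using V(1) by (intro card_mono) (auto simp: nbhd_def)
  ultimately show "c \<le> h" using H V(5) by fastforce
  have "m * c \<le> card ?P * c" using mP by simp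
  also have "\<dots> \<le> (\<Sum>v\<in>?P. card (nbhd ?H E v))"
    using sum_mono[of ?P "\<lambda>_. c"] H by simp
  also have "\<dots> \<le> (\<Sum>v\<in>V. card (nbhd ?H E v))"
    using V(1) by (intro sum_mono2) auto
  also have "\<dots> = (\<Sum>u\<in>?H. card (nbhd V E u))"
    using V by (intro sum_card_nbhd_sym) auto
  also have "\<dots> = h * d" using reg V(5) by simp
  finally show "m * c \<le> h * d" .
qed

text \<open>The row sums give each block average degree \<open>d\<close>, and each block in
  \<open>P\<close> has at least \<open>c\<close> happy neighbours on average; equalising turns these
  averages into statements about every vertex.\<close>

lemma ex_approving_of_blocks:
  fixes s :: "nat \<Rightarrow> nat" and e :: "nat \<Rightarrow> nat \<Rightarrow> nat"
  assumes sym: "\<And>i j. e i j = e j i"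
    and off: "\<And>i j. i < k \<Longrightarrow> j < k \<Longrightarrow> i \<noteq> j \<Longrightarrow> e i j \<le> s i * s j"
    and diag: "\<And>i. i < k \<Longrightarrow> s i \<le> e i i" "\<And>i. i < k \<Longrightarrow> even (e i i + s i)"
      "\<And>i. i < k \<Longrightarrow> e i i \<le> s i * s i"
    and row: "\<And>i. i < k \<Longrightarrow> (\<Sum>j<k. e i j) = d * s i"
    and d: "d + 1 = 2 * c" and P: "P \<subseteq> {..<k}" "\<And>i. i \<in> P \<Longrightarrow> c * s i \<le> e i 0"
    and maj: "(\<Sum>i<k. s i) < 2 * (\<Sum>i\<in>P. s i)" and k: "0 < k"
  shows "\<exists>(V, E, f) \<in> (config_class (\<Sum>i<k. s i) d (s 0) :: nat configuration set). approving V E f"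
proof -
  obtain V :: "nat set" and cls where V: "finite V" "\<And>v. v \<in> V \<Longrightarrow> cls v < k"
    and card0: "\<And>i. card (block V cls i) = (if i < k then s i else 0)"
    using ex_blocks[of k s] by metis
  define B where "B = block V cls"
  have finB: "finite (B i)" for i using V by (simp add: B_def block_def)
  have cardB: "card (B i) = s i" if "i < k" for i using card0 that by (simp add: B_def)
  have disj: "B i \<inter> B j = {}" if "i \<noteq> j" for i j using that by (auto simp: B_def block_def)
  have VB: "V = (\<Union>i\<in>{..<k}. B i)" using V(2) by (auto simp: B_def block_def)
  have cardV: "card V = (\<Sum>i<k. s i)"
    unfolding VB using finB disj cardB by (subst card_UN_disjoint) auto
  \<comment> \<open>Extended by zero, as the block graph is built for all indices at once.\<close>
  define e' where "e' i j = (if i < k \<and> j < k then e i j else 0)" for i j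
  obtain E0 where E0: "graph_with_loops V E0"
      "\<And>i j. card (E0 \<inter> block V cls i \<times> block V cls j) = e' i j"
  proof (rule ex_block_graph[OF V(1), of e' cls "\<lambda>i. (e' i i - card (block V cls i)) div 2"])
    show "e' i j = e' j i" for i j using sym by (simp add: e'_def)
    show "e' i j \<le> card (block V cls i) * card (block V cls j)" if "i \<noteq> j" for i j
      using off that by (simp add: e'_def card0)
    show "e' i i \<le> card (block V cls i) * card (block V cls i)" for i
      using diag(3) by (simp add: e'_def card0)
    show "e' i i = card (block V cls i) + 2 * ((e' i i - card (block V cls i)) div 2)" for i
      using diag(1,2)[of i] by (simp add: e'_def card0)
  qed (rule that, auto)
  obtain E where g: "graph_with_loops V E"
    and cnt: "\<And>i j. card (E \<inter> block V cls i \<times> block V cls j) = card (E0 \<inter> block V cls i \<times> block V cls j)"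
    and tot: "\<And>x x'. x \<in> V \<Longrightarrow> x' \<in> V \<Longrightarrow> cls x = cls x' \<Longrightarrow> card (nbhd V E x) \<le> card (nbhd V E x') + 1"
    and hap: "\<And>x x'. x \<in> V \<Longrightarrow> x' \<in> V \<Longrightarrow> cls x = cls x' \<Longrightarrow>
       card (nbhd (block V cls 0) E x) \<le> card (nbhd (block V cls 0) E x') + 1"
    using ex_equalized_graph[OF E0(1), of cls] by blast
  have B_mem: "v \<in> B i \<longleftrightarrow> v \<in> V \<and> cls v = i" for v i by (auto simp: B_def block_def)
  have cnt': "card (E \<inter> B i \<times> B j) = e i j" if "i < k" "j < k" for i j
    using that cnt E0(2) by (simp add: B_def e'_def)
  have reg: "card (nbhd V E v) = d" if "v \<in> V" for v
  proof -
    let ?i = "cls v"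
    have i: "?i < k" "v \<in> B ?i" using V(2) that by (auto simp: B_mem)
    have "E \<inter> B ?i \<times> V = (\<Union>j\<in>{..<k}. E \<inter> B ?i \<times> B j)" by (subst VB) blast
    moreover have "card (\<Union>j\<in>{..<k}. E \<inter> B ?i \<times> B j) = (\<Sum>j<k. card (E \<inter> B ?i \<times> B j))"
      using finB disj by (intro card_UN_disjoint) blast+
    ultimately have sum: "(\<Sum>v\<in>B ?i. card (nbhd V E v)) = d * card (B ?i)"
      using sum_card_nbhd[of "B ?i" V E, OF finB V(1)] cnt' row i cardB by simp
    have near: "card (nbhd V E x) \<le> card (nbhd V E y) + 1" if "x \<in> B ?i" "y \<in> B ?i" for x y
      using tot that by (simp add: B_mem)
    show ?thesis
    proof (rule antisym)
      show "card (nbhd V E v) \<le> d"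
        by (rule near_constant_le[OF finB near _ i(2)]) (simp_all add: sum)
      show "d \<le> card (nbhd V E v)"
        by (rule near_constant_ge[OF finB near _ i(2)]) (simp_all add: sum)
    qed
  qed
  define f :: "nat \<Rightarrow> int" where "f v = (if v \<in> B 0 then 1 else -1)" for v
  have op: "opinion_function V f" by (auto simp: opinion_function_def f_def)
  have hB: "{v \<in> V. happy f v} = B 0" by (auto simp: happy_def f_def B_mem)
  have propon: "proponent V E f v" if "i \<in> P" "v \<in> B i" for i v
  proof -
    have i: "i < k" using P that by auto
    have near: "card (nbhd (B 0) E x) \<le> card (nbhd (B 0) E y) + 1" if "x \<in> B i" "y \<in> B i" for x y
      using hap that by (simp add: B_mem B_def[symmetric])
    have "c * card (B i) \<le> (\<Sum>v\<in>B i. card (nbhd (B 0) E v))"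
      using sum_card_nbhd[of "B i" "B 0" E, OF finB finB] cnt'[OF i k] P(2)[OF that(1)] cardB[OF i] by simp
    from near_constant_ge[OF finB near this that(2)] have "c \<le> card (nbhd (B 0) E v)" .
    moreover have "v \<in> V" using that by (simp add: B_mem)
    ultimately show ?thesis using proponent_iff[OF V(1) op, of E v c] reg[of v] d hB by simp
  qed
  have "(\<Sum>i\<in>P. s i) = card (\<Union>i\<in>P. B i)"
    using P(1) finB disj cardB finite_subset[OF P(1)]
    by (subst card_UN_disjoint) (auto intro!: sum.cong)
  also have "\<dots> \<le> card {v \<in> V. proponent V E f v}"
    using V(1) propon by (intro card_mono) (auto simp: B_mem)
  finally have "card V < 2 * card {v \<in> V. proponent V E f v}"
    using maj cardV by linarith
  then have "real (card V) / 2 < real (card {v \<in> V. proponent V E f v})" by linarith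
  then have "approving V E f" by (simp add: approving_def)
  moreover have "(V, E, f) \<in> config_class (\<Sum>i<k. s i) d (s 0)"
    using g op reg cardV hB cardB[OF k] by (simp add: config_class_def regular_def)
  ultimately show ?thesis by blast
qed

text \<open>The flag \<open>p\<close> decides whether the happy block is counted among the
  proponents besides block 1.\<close>

lemma ex_approving_of_three_blocks:
  fixes s0 s1 s2 :: nat
  assumes off: "e01 \<le> s0 * s1" "e02 \<le> s0 * s2" "e12 \<le> s1 * s2"
    and diag: "s0 \<le> e00" "e00 \<le> s0 * s0" "even (e00 + s0)"
      "s1 \<le> e11" "e11 \<le> s1 * s1" "even (e11 + s1)"
      "s2 \<le> e22" "e22 \<le> s2 * s2" "even (e22 + s2)"
    and row: "e00 + e01 + e02 = d * s0" "e01 + e11 + e12 = d * s1" "e02 + e12 + e22 = d * s2"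
    and d: "d + 1 = 2 * c" and p: "p \<Longrightarrow> c * s0 \<le> e00" "c * s1 \<le> e01"
    and n: "n = s0 + s1 + s2" "n < 2 * (s1 + (if p then s0 else 0))"
  shows "\<exists>(V, E, f) \<in> (config_class n d s0 :: nat configuration set). approving V E f"
proof -
  define s where "s i = [s0, s1, s2] ! i" for i
  define e where "e i j = (if i < 3 \<and> j < 3 then [[e00, e01, e02], [e01, e11, e12], [e02, e12, e22]] ! i ! j else 0)" for i j
  have I: "{..<3 :: nat} = {0, 1, 2}" by auto
  have lt3: "i < 3 \<longleftrightarrow> i = 0 \<or> i = 1 \<or> i = 2" for i :: nat by auto
  have sum: "(\<Sum>i<3. s i) = n" by (simp add: I s_def n)
  define P where "P = (if p then {0, 1} else {1 :: nat})"
  have "\<exists>(V, E, f) \<in> (config_class (\<Sum>i<3. s i) d (s 0) :: nat configuration set). approving V E f"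
  proof (rule ex_approving_of_blocks[where e = e and c = c and P = P])
    show "e i j = e j i" for i j by (auto simp: e_def lt3)
    show "e i j \<le> s i * s j" if "i < 3" "j < 3" "i \<noteq> j" for i j
      using that off by (auto simp: e_def s_def lt3 mult.commute)
    show "s i \<le> e i i" "even (e i i + s i)" "e i i \<le> s i * s i" if "i < 3" for i
      using that diag by (auto simp: e_def s_def lt3)
    show "(\<Sum>j<3. e i j) = d * s i" if "i < 3" for i
      using that row by (auto simp: I e_def s_def lt3)
    show "c * s i \<le> e i 0" if "i \<in> P" for i
      using that p by (auto simp: P_def e_def s_def split: if_splits)
    show "(\<Sum>i<3. s i) < 2 * (\<Sum>i\<in>P. s i)"
      unfolding sum using n(2) by (auto simp: P_def s_def)
  qed (use d in \<open>auto simp: P_def\<close>)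
  then show ?thesis by (simp add: sum) (simp add: s_def)
qed

section \<open>Constructions that meet the lower bound\<close>

abbreviation attainable :: "nat \<Rightarrow> nat \<Rightarrow> nat \<Rightarrow> bool" where
  "attainable n d h \<equiv> \<exists>(V, E, f) \<in> (config_class n d h :: nat configuration set). approving V E f"

text \<open>In the following lemmas the blocks are the happy vertices, the sad proponents and the remaining
  vertices, unless stated otherwise. The correction \<open>\<alpha>\<close> below repairs the parity of the number of
  edges inside the first block; the surplus of \<open>h d\<close> over \<open>m c\<close> always leaves room for it.\<close>

lemma attainable_of_slack:
  fixes a b g :: nat
  assumes g: "b < g" and lb: "a * (b + 1) \<le> (g + 1) * b"
    and minimal: "g * (2 * b + 1) < (g + 1 + a) * (b + 1)"
  shows "attainable (2 * (g + 1 + a) - 1) (2 * b + 1) (g + 1)"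
proof -
  \<comment> \<open>Here \<open>c = b + 1\<close>, \<open>h = g + 1\<close> and
    \<open>m = g + 1 + a\<close>: the proponents are all happy vertices and \<open>a\<close> sad
    ones, and \<open>q\<close> vertices remain. After cancelling, \<open>lb\<close> is
    \<open>m * c \<le> h * d\<close>.\<close>
  define q where "q = g + a"
  define \<alpha> where "\<alpha> = ((g + 1) * b) mod 2"
  define w where "w = ((g + 1) * b) div 2"
  have gb: "(g + 1) * b = \<alpha> + 2 * w" and \<alpha>: "\<alpha> \<le> 1" by (auto simp: \<alpha>_def w_def)
  \<comment> \<open>If \<open>lb\<close> is an equality there is no room for a correction, but then
    \<open>(g + 1) * b\<close> is even: either \<open>b\<close> is even or \<open>b + 1\<close>
    is.\<close>
  have slack: "a * (b + 1) + \<alpha> \<le> (g + 1) * b"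
  proof (cases "a * (b + 1) = (g + 1) * b")
    case True
    have "even ((g + 1) * b)"
    proof (cases "even b")
      case False
      then have "even (a * (b + 1))" by simp
      then show ?thesis using True by metis
    qed simp
    then show ?thesis using lb by (simp add: \<alpha>_def)
  next
    case False
    then show ?thesis using lb \<alpha> by linarith
  qed
  \<comment> \<open>What the happy vertices have left for the remaining block, namely
    \<open>h * d - m * c - \<alpha>\<close>.\<close>
  then obtain \<gamma> where \<gamma>: "a * (b + 1) + \<alpha> + \<gamma> = (g + 1) * b" using le_Suc_ex[OF slack] by metis
  \<comment> \<open>By minimality of \<open>h\<close> the surplus \<open>h * d - m * c\<close> is
    less than \<open>d\<close>.\<close>
  have \<gamma>_le: "\<gamma> \<le> 2 * b"
    using \<gamma> minimal by (simp add: algebra_simps)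
  \<comment> \<open>\<open>c * d \<le> (h - 1) * d < m * c\<close>, hence
    \<open>d < m\<close>.\<close>
  have "(b + 1) * (2 * b + 1) < (g + 1 + a) * (b + 1)"
    using minimal g mult_le_mono1[of "b + 1" g "2 * b + 1"] by linarith
  then have "(2 * b + 1) * (b + 1) < (q + 1) * (b + 1)"
    by (simp only: mult.commute[of "b + 1"] q_def) (simp add: algebra_simps)
  then have d_le: "2 * b + 1 \<le> q" using mult_less_cancel2[of "2 * b + 1" "b + 1" "q + 1"] by linarith
  \<comment> \<open>Sad proponents have \<open>b + 1\<close> happy neighbours and their loop, so
    each sends \<open>b - 1\<close> edges to the remaining block. If \<open>b = 0\<close>, then
    \<open>lb\<close> forces \<open>a = 0\<close>.\<close>
  obtain AQ where AQ: "AQ + 2 * a = a * (b + 1)" "AQ \<le> a * q" "b = 0 \<Longrightarrow> AQ = 0" "b > 0 \<Longrightarrow> AQ + q \<le> b * q"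
  proof (cases b)
    case 0
    then show ?thesis using lb by (intro that[of 0]) auto
  next
    case (Suc b')
    have "a * b' \<le> a * q" "a * b' \<le> q * b'" using d_le Suc by (auto simp: q_def)
    then show ?thesis using Suc by (intro that[of "a * b'"]) (auto simp: algebra_simps)
  qed
  have QQ_ge: "\<gamma> + AQ \<le> 2 * b * q"
    using AQ(3,4) \<gamma>_le d_le by (cases "b = 0") auto
  then obtain QQ where QQ: "\<gamma> + AQ + QQ = (2 * b + 1) * q" "q \<le> QQ"
    using le_Suc_ex[of "\<gamma> + AQ + q" "(2 * b + 1) * q"] by (auto simp: add.assoc)
  have "QQ \<le> (2 * b + 1) * q" using QQ(1) by linarith
  also have "\<dots> \<le> q * q" using d_le by (intro mult_le_mono1)
  finally have QQ_le: "QQ \<le> q * q" .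
  \<comment> \<open>By the choice of \<alpha>, \<open>\<gamma> + AQ\<close> is even, which leaves
    the right parity for the inside of the last block.\<close>
  have QQ_even: "even (QQ + q)"
  proof -
    have "\<gamma> + AQ + 2 * a = 2 * w" using \<gamma> gb AQ(1) by linarith
    then have "even (\<gamma> + AQ)" by presburger
    moreover have "\<gamma> + AQ + (QQ + q) = 2 * ((b + 1) * q)" using QQ(1) by (simp add: algebra_simps)
    then have "even (\<gamma> + AQ + (QQ + q))" by (metis dvd_triv_left)
    ultimately show ?thesis using even_add by blast
  qed
  have HQ: "\<gamma> \<le> (g + 1) * q" using \<gamma>_le d_le by simp
  \<comment> \<open>Strictness of \<open>b < g\<close> makes room for \<alpha>.\<close>
  have HH: "(g + 1) * (b + 1) + \<alpha> \<le> (g + 1) * (g + 1)"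
  proof -
    have "(g + 1) * (b + 1) + (g + 1) \<le> (g + 1) * (g + 1)"
      using g mult_le_mono2[of "b + 2" "g + 1" "g + 1"] by simp
    then show ?thesis using \<alpha> by linarith
  qed
  have HH_even: "even ((g + 1) * (b + 1) + \<alpha> + (g + 1))"
  proof -
    have "(g + 1) * (b + 1) + \<alpha> + (g + 1) = 2 * (w + \<alpha> + g + 1)" using gb by simp
    then show ?thesis by (metis dvd_triv_left)
  qed
  show ?thesis
  proof (rule ex_approving_of_three_blocks[where c = "b + 1" and p = True and ?s1.0 = a and ?s2.0 = q
        and ?e00.0 = "(g + 1) * (b + 1) + \<alpha>" and ?e01.0 = "(b + 1) * a" and ?e02.0 = \<gamma>
        and ?e11.0 = a and ?e12.0 = AQ and ?e22.0 = QQ])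
    show "(b + 1) * a \<le> (g + 1) * a" using g by (intro mult_le_mono1) simp
    show "(g + 1) * (b + 1) + \<alpha> + (b + 1) * a + \<gamma> = (2 * b + 1) * (g + 1)"
      using \<gamma> by (simp add: algebra_simps)
    show "(b + 1) * a + a + AQ = (2 * b + 1) * a"
      using AQ(1) by (simp add: algebra_simps)
  qed (use AQ(2) QQ QQ_le QQ_even HQ HH HH_even in \<open>auto simp: q_def\<close>)
qed

text \<open>Case \<open>h = c\<close>, \<open>m = c + a\<close>: each proponent must see all happy
  vertices. The remaining block is complete as well, and each sad proponent misses two others of its
  kind, which requires \<open>a \<ge> 3\<close>.\<close>

lemma attainable_tight:
  fixes x r :: nat
  defines "a \<equiv> x + 3"
  shows "attainable (2 * (2 * a + r + 1) - 1) (2 * (a + r) + 1) (a + r + 1)"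
proof (rule ex_approving_of_three_blocks[where c = "a + r + 1" and p = True and ?s1.0 = a and ?s2.0 = "2 * a + r"
      and ?e00.0 = "(a + r + 1) * (a + r + 1)" and ?e01.0 = "(a + r + 1) * a" and ?e02.0 = "(a + r + 1) * r"
      and ?e11.0 = "a * (x + 1)" and ?e12.0 = "a * (r + 2)" and ?e22.0 = "(2 * a + r) * (2 * a + r)"])
  show "even (a * (x + 1) + a)" by (simp add: a_def)
  show "a * (r + 2) \<le> a * (2 * a + r)" by (intro mult_le_mono2) (simp add: a_def)
  show "a * (x + 1) \<le> a * a" by (intro mult_le_mono2) (simp add: a_def)
  show "(a + r + 1) * r \<le> (a + r + 1) * (2 * a + r)" by (intro mult_le_mono2) simp
  show "(a + r + 1) * (a + r + 1) + (a + r + 1) * a + (a + r + 1) * r = (2 * (a + r) + 1) * (a + r + 1)"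
    by (simp add: algebra_simps)
  show "(a + r + 1) * a + a * (x + 1) + a * (r + 2) = (2 * (a + r) + 1) * a"
    by (simp add: a_def algebra_simps)
  show "(a + r + 1) * r + a * (r + 2) + (2 * a + r) * (2 * a + r) = (2 * (a + r) + 1) * (2 * a + r)"
    by (simp add: algebra_simps)
qed (auto simp: a_def)

text \<open>Case \<open>h = c = m\<close>, where all edges are present and no sad proponents are
  needed.\<close>

lemma attainable_complete: "attainable (2 * q + 1) (2 * q + 1) (q + 1)"
  by (intro ex_approving_of_three_blocks[where c = "q + 1" and p = True and ?s1.0 = 0 and ?s2.0 = q
      and ?e00.0 = "(q + 1) * (q + 1)" and ?e01.0 = 0 and ?e02.0 = "(q + 1) * q"
      and ?e11.0 = 0 and ?e12.0 = 0 and ?e22.0 = "q * q"])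
    (auto simp: algebra_simps)

text \<open>For \<open>d = n - 2\<close> and \<open>d = n - 4\<close> the proponents are exactly the sad vertices.\<close>

lemma attainable_sad_proponents1:
  fixes x :: nat
  shows "attainable (2 * (x + 4) - 1) (2 * x + 5) (x + 3)"
  \<comment> \<open>Each vertex misses two others of its own block, so both blocks need at least
    three vertices.\<close>
  by (intro ex_approving_of_three_blocks[where c = "x + 3" and p = False and ?s1.0 = "x + 4" and ?s2.0 = 0
      and ?e00.0 = "(x + 3) * (x + 1)" and ?e01.0 = "(x + 3) * (x + 4)" and ?e02.0 = 0
      and ?e11.0 = "(x + 4) * (x + 2)" and ?e12.0 = 0 and ?e22.0 = 0])
    (auto simp: algebra_simps)

lemma attainable_sad_proponents2:
  fixes x :: nat
  shows "attainable (2 * (x + 7) - 1) (2 * x + 9) (x + 5)"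
  \<comment> \<open>Now four are missed, so the happy block needs at least five vertices.\<close>
  by (intro ex_approving_of_three_blocks[where c = "x + 5" and p = False and ?s1.0 = "x + 8" and ?s2.0 = 0
      and ?e00.0 = "(x + 5) * (x + 1)" and ?e01.0 = "(x + 5) * (x + 8)" and ?e02.0 = 0
      and ?e11.0 = "(x + 8) * (x + 4)" and ?e12.0 = 0 and ?e22.0 = 0])
    (auto simp: algebra_simps)

text \<open>The complement of this graph on 11 vertices is \<open>K\<^sub>5\<close> plus the octahedron; the proponents
  are the vertices of the octahedron, all of them sad.\<close>

lemma attainable_11_7: "attainable 11 7 4"
  by (rule ex_approving_of_three_blocks[where c = 4 and p = False and ?s1.0 = 6 and ?s2.0 = 1
      and ?e00.0 = 4 and ?e01.0 = 24 and ?e02.0 = 0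
      and ?e11.0 = 12 and ?e12.0 = 6 and ?e22.0 = 1]) auto

text \<open>The construction depends on which of the two bounds is critical for \<open>h\<close>. If
  it is \<open>c \<le> h\<close>, then \<open>h = c\<close>, and the difference \<open>a\<close> of
  \<open>m\<close> and \<open>c\<close> decides.\<close>

lemma attainable_bound:
  assumes n: "n + 1 = 2 * m" "n \<notin> {5, 9}" and d: "d + 1 = 2 * c" and cm: "c \<le> m"
    and lb: "c \<le> h" "m * c \<le> h * d" and minimal: "h = c \<or> (h - 1) * d < m * c"
  shows "attainable n d h"
proof -
  have c: "0 < c" "0 < h" using d lb by auto
  have nd: "n = 2 * m - 1" "d = 2 * c - 1" using n d by auto
  show ?thesis
  proof (cases "h = c")
    case False
    define b where "b = c - 1"
    define g where "g = h - 1"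
    have bg: "c = b + 1" "h = g + 1" "b < g" "d = 2 * b + 1"
      using c False lb nd by (auto simp: b_def g_def)
    have min: "g * (2 * b + 1) < m * (b + 1)" using minimal False bg by simp
    have "g * (b + 1) \<le> g * (2 * b + 1)" by simp
    with min have "g * (b + 1) < m * (b + 1)" by linarith
    then have "g < m" using mult_less_cancel2[of g "b + 1" m] by blast
    then obtain a where a: "m = g + 1 + a" using le_Suc_ex[of "g + 1" m] by auto
    have "a * (b + 1) \<le> (g + 1) * b" using lb(2) a bg by (simp add: algebra_simps)
    from attainable_of_slack[OF bg(3) this] min show ?thesis using nd bg a by simp
  next
    case True
    have "m \<le> d" using lb(2) True c by (simp add: mult.commute)
    obtain a where a: "m = c + a" using le_Suc_ex[OF cm] by blast
    consider "a = 0" | "a = 1" | "a = 2" | "a \<ge> 3" by linarith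
    then show ?thesis
    proof cases
      case 1
      obtain q where "c = q + 1" using c(1) using le_Suc_ex[of 1 c] by auto
      then show ?thesis using attainable_complete[of q] 1 a True nd by simp
    next
      case 2
      \<comment> \<open>\<open>c = 2\<close> would mean \<open>n = 5\<close>.\<close>
      then have "3 \<le> c" using \<open>m \<le> d\<close> a nd n(2) by auto
      then obtain x where "c = x + 3" using le_Suc_ex[of 3 c] by auto
      then show ?thesis using attainable_sad_proponents1[of x] 2 a True nd by (simp add: algebra_simps)
    next
      case 3
      \<comment> \<open>\<open>c = 3\<close> would mean \<open>n = 9\<close>.\<close>
      then have "c = 4 \<or> 5 \<le> c" using \<open>m \<le> d\<close> a nd n(2) by auto
      then show ?thesis
      proof
        assume "c = 4"
        then show ?thesis using attainable_11_7 3 a True nd by simp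
      next
        assume "5 \<le> c"
        then obtain x where "c = x + 5" using le_Suc_ex[of 5 c] by auto
        then show ?thesis using attainable_sad_proponents2[of x] 3 a True nd by (simp add: algebra_simps)
      qed
    next
      case 4
      obtain x where x: "a = x + 3" using 4 le_Suc_ex[of 3 a] by auto
      have "a + 1 \<le> c" using \<open>m \<le> d\<close> a nd c by simp
      then obtain r where r: "c = a + r + 1" using le_Suc_ex[of "a + 1" c] by auto
      then show ?thesis using attainable_tight[of x r] a True nd x by (simp add: algebra_simps)
    qed
  qed
qed

text \<open>Both bounds are monotone in \<open>h\<close>. Their least common solution is attained
  and nothing below it is, so it is the minimum.\<close>

lemma h_min_deg_le_iff:
  assumes n: "n + 1 = 2 * m" "n \<notin> {5, 9}" and d: "d + 1 = 2 * c" and cm: "c \<le> m"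
  shows "h_min_deg n d \<le> h \<longleftrightarrow> c \<le> h \<and> m * c \<le> h * d"
proof -
  define Q where "Q h \<longleftrightarrow> c \<le> h \<and> m * c \<le> h * d" for h
  define h0 where "h0 = (LEAST h. Q h)"
  have "0 < d" using d by presburger
  \<comment> \<open>Some solution of \<open>Q\<close>, chosen large for convenience.\<close>
  then have "Q (m * c + c)" by (auto simp: Q_def add_mult_distrib intro: trans_le_add1)
  then have Q0: "Q h0" unfolding h0_def by (rule LeastI)
  have least: "h0 \<le> h" if "Q h" for h unfolding h0_def using that by (rule Least_le)
  have "h0 = c \<or> (h0 - 1) * d < m * c"
  proof (rule ccontr)
    assume "\<not> ?thesis"
    then have "Q (h0 - 1)" "h0 \<noteq> 0" using Q0 d by (auto simp: Q_def)
    then show False using least[of "h0 - 1"] by simp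
  qed
  then have att: "attainable n d h0" using attainable_bound[OF n d cm] Q0 by (simp add: Q_def)
  have low: "Q h" if "attainable n d h" for h
    using that approving_config_lower_bound[OF _ _ n(1) d] by (auto simp: Q_def)
  have "h_min_deg n d = h0"
    unfolding h_min_deg_def using att low least by (intro Least_equality) blast+
  moreover have "h0 \<le> h \<longleftrightarrow> Q h"
  proof
    assume "h0 \<le> h"
    then show "Q h" using Q0 mult_le_mono1[of h0 h d] le_trans unfolding Q_def by blast
  qed (rule least)
  ultimately show ?thesis by (simp add: Q_def)
qed

section \<open>The segments\<close>

lemma odd_degrees_iff:
  assumes "n + 1 = 2 * m"
  shows "d \<in> odd_degrees n \<longleftrightarrow> (\<exists>c. d + 1 = 2 * c \<and> 1 \<le> c \<and> c \<le> m)"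
proof
  assume d: "d \<in> odd_degrees n"
  then have "odd d" by (simp add: odd_degrees_def)
  then obtain c where "d = 2 * c + 1" by (rule oddE)
  then show "\<exists>c. d + 1 = 2 * c \<and> 1 \<le> c \<and> c \<le> m"
    using d assms by (intro exI[of _ "c + 1"]) (auto simp: odd_degrees_def)
next
  assume "\<exists>c. d + 1 = 2 * c \<and> 1 \<le> c \<and> c \<le> m"
  then obtain c where c: "d + 1 = 2 * c" "1 \<le> c" "c \<le> m" by blast
  then have "odd d" by presburger
  moreover have "1 \<le> d" "d \<le> n" using c assms by linarith+
  ultimately show "d \<in> odd_degrees n" by (simp add: odd_degrees_def)
qed

text \<open>Add \<open>h\<close> to both sides of \<open>m * c \<le> h * d\<close> and use
  \<open>h * (d + 1) = 2 * h * c = m * c + e * c\<close>.\<close>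

lemma degrees_le_eq:
  assumes n: "n + 1 = 2 * m" "n \<notin> {5, 9}" and h: "2 * h = m + e"
  shows "{d \<in> odd_degrees n. h_min_deg n d \<le> h} =
    {d. \<exists>c. d + 1 = 2 * c \<and> 1 \<le> c \<and> c \<le> m \<and> c \<le> h \<and> h \<le> e * c}"
proof -
  have "h_min_deg n d \<le> h \<longleftrightarrow> c \<le> h \<and> h \<le> e * c" if c: "d + 1 = 2 * c" "c \<le> m" for d c
  proof -
    have "h * d + h = h * (d + 1)" by simp
    also have "\<dots> = (2 * h) * c" using c by simp
    also have "\<dots> = m * c + e * c" by (simp only: h add_mult_distrib)
    finally have "m * c \<le> h * d \<longleftrightarrow> h \<le> e * c" by linarith
    then show ?thesis using h_min_deg_le_iff[OF n c] by simp
  qed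
  then show ?thesis unfolding odd_degrees_iff[OF n(1)] by blast
qed

section \<open>The minimum over all degrees\<close>

lemma finite_odd_degrees: "finite (odd_degrees n)"
  by (simp add: odd_degrees_def)

text \<open>\<open>2 * h \<le> m\<close> would give
  \<open>2 * h * c \<le> m * c \<le> h * d < 2 * h * c\<close>. For the next value of
  \<open>h\<close> a degree near \<open>m\<close> works.\<close>

lemma h_min_eq:
  assumes n: "n + 1 = 2 * m" "n \<notin> {5, 9}" and m: "0 < m"
  shows "h_min n = m div 2 + 1"
proof -
  have "1 \<le> n" using n(1) by presburger
  then have ne: "odd_degrees n \<noteq> {}" by (auto simp: odd_degrees_def intro!: exI[of _ 1])
  define h where "h = m div 2 + 1"
  have "h \<le> h_min_deg n d" if d: "d \<in> odd_degrees n" for d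
  proof (rule ccontr)
    assume lt: "\<not> h \<le> h_min_deg n d"
    obtain c where c: "d + 1 = 2 * c" "1 \<le> c" "c \<le> m" using d odd_degrees_iff[OF n(1)] by blast
    let ?h = "h_min_deg n d"
    have *: "c \<le> ?h" "m * c \<le> ?h * d" using h_min_deg_le_iff[OF n c(1,3), of ?h] by auto
    have "2 * ?h \<le> m" using lt by (simp add: h_def)
    then have "2 * ?h * c \<le> m * c" by (intro mult_le_mono1)
    moreover have "?h * d + ?h = ?h * (d + 1)" by simp
    moreover have "?h * (d + 1) = 2 * ?h * c" using c by simp
    ultimately show False using * c by linarith
  qed
  moreover have "\<exists>d\<in>odd_degrees n. h_min_deg n d \<le> h"
  proof -
    define e where "e = 2 - m mod 2"
    have h: "2 * h = m + e" unfolding h_def e_def by presburger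
    \<comment> \<open>For odd \<open>m\<close> the excess \<open>e\<close> is 1 and forces
      \<open>c = h\<close>, which is this value; it also serves for even \<open>m\<close>.\<close>
    define c where "c = (m + 1) div 2"
    have "1 \<le> c" "c \<le> m" "c \<le> h"
      using m by (auto simp: c_def h_def)
    moreover have "h \<le> e * c"
      using m by (cases "even m") (auto simp: c_def h_def e_def elim!: evenE oddE)
    moreover have "2 * c - 1 + 1 = 2 * c" using \<open>1 \<le> c\<close> by simp
    ultimately have "2 * c - 1 \<in> {d \<in> odd_degrees n. h_min_deg n d \<le> h}"
      unfolding degrees_le_eq[OF n h] by blast
    then show ?thesis by blast
  qed
  ultimately show ?thesis
    unfolding h_min_def h_def[symmetric] using ne finite_odd_degrees
    by (intro antisym) (auto simp: Min_le_iff Min_ge_iff)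
qed

text \<open>No degree lies below the minimum, so equality becomes a threshold, as for the near
  optimal degrees.\<close>

lemma optimal_degrees_eq: "optimal_degrees n = {d \<in> odd_degrees n. h_min_deg n d \<le> h_min n}"
proof -
  have "h_min n \<le> h_min_deg n d" if "d \<in> odd_degrees n" for d
    unfolding h_min_def using finite_odd_degrees that by (intro Min_le) auto
  then have "h_min_deg n d = h_min n \<longleftrightarrow> h_min_deg n d \<le> h_min n" if "d \<in> odd_degrees n" for d
    using that by (simp add: order_eq_iff)
  then show ?thesis unfolding optimal_degrees_def by blast
qed

text \<open>The map from \<open>c\<close> to \<open>2 * c - 1\<close> carries the interval from
  \<open>A\<close> to \<open>B\<close> onto the odd numbers between the end points;
  \<open>1 \<le> A\<close> keeps these positive.\<close>

lemma is_segment_degrees_le: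
  assumes n: "n + 1 = 2 * m" "n \<notin> {5, 9}" and h: "2 * h = m + e"
    and AB: "\<And>c. 1 \<le> c \<and> c \<le> m \<and> c \<le> h \<and> h \<le> e * c \<longleftrightarrow> A \<le> c \<and> c \<le> B" and A: "1 \<le> A"
    and ab: "a = 2 * real A - 1" "b = 2 * real B - 1" "len = b - a"
  shows "is_segment {d \<in> odd_degrees n. h_min_deg n d \<le> h} a b len"
proof -
  have D: "{d \<in> odd_degrees n. h_min_deg n d \<le> h} = {d. \<exists>c. d + 1 = 2 * c \<and> A \<le> c \<and> c \<le> B}"
    unfolding degrees_le_eq[OF n h] AB ..
  have "int ` {d. \<exists>c. d + 1 = 2 * c \<and> A \<le> c \<and> c \<le> B} =
      {x. odd x \<and> 2 * int A - 1 \<le> x \<and> x \<le> 2 * int B - 1}" (is "?L = ?R")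
  proof
    show "?L \<subseteq> ?R"
    proof clarify
      fix d c assume c: "d + 1 = 2 * c" "A \<le> c" "c \<le> B"
      then have "odd d" by presburger
      then show "odd (int d) \<and> 2 * int A - 1 \<le> int d \<and> int d \<le> 2 * int B - 1" using c by auto
    qed
    show "?R \<subseteq> ?L"
    proof
      fix x assume x: "x \<in> ?R"
      then obtain y where y: "x = 2 * y + 1" by (auto elim: oddE)
      then have "int (nat x) = x" "nat x + 1 = 2 * nat (y + 1)" "A \<le> nat (y + 1)" "nat (y + 1) \<le> B"
        using x A by auto
      then show "x \<in> ?L" by (metis (mono_tags, lifting) image_eqI mem_Collect_eq)
    qed
  qed
  moreover have "a = of_int (2 * int A - 1)" "b = of_int (2 * int B - 1)" "odd (2 * int A - 1)" "odd (2 * int B - 1)"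
    using ab by auto
  ultimately show ?thesis unfolding is_segment_def D using ab(3) by blast
qed

theorem proposition18:
  fixes n :: nat
  assumes "n > 0" and "odd n" and "n \<notin> {5, 9}"
  shows
    "((\<exists>k::nat. k \<ge> 1 \<and> (int n = 8 * int k - 3 \<or> int n = 8 * int k - 7)) \<longrightarrow>
        real (h_min n) = (real n + 3) / 4 \<and>
        is_segment (optimal_degrees n) ((real n + 1) / 2) ((real n + 1) / 2) 0)
   \<and> ((\<exists>k::nat. k \<ge> 1 \<and> int n = 8 * int k - 1) \<longrightarrow>
        real (h_min n) = (real n + 5) / 4 \<and>
        is_segment (optimal_degrees n)
          ((real n + 5) / 4) ((real n + 3) / 2) ((real n + 1) / 4))
   \<and> ((\<exists>k::nat. k \<ge> 1 \<and> int n = 8 * int k - 5) \<longrightarrow>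
        real (h_min n) = (real n + 5) / 4 \<and>
        is_segment (optimal_degrees n)
          ((real n + 1) / 4) ((real n + 3) / 2) ((real n + 5) / 4))
   \<and> ((\<exists>l::nat. l \<ge> 1 \<and> int n = 12 * int l - 3) \<longrightarrow>
        is_segment (near_optimal_degrees n)
          ((real n + 9) / 6) ((real n + 5) / 2) ((real n + 3) / 3))
   \<and> ((\<exists>l::nat. l \<ge> 1 \<and> int n = 12 * int l - 7) \<longrightarrow>
        is_segment (near_optimal_degrees n)
          ((real n + 1) / 6) ((real n + 5) / 2) ((real n + 7) / 3))
   \<and> ((\<exists>l::nat. l \<ge> 1 \<and> int n = 12 * int l - 11) \<longrightarrow>
        is_segment (near_optimal_degrees n)
          ((real n + 5) / 6) (min ((real n + 5) / 2) (real n))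
          (min ((real n + 5) / 3) (real n - 1)))
   \<and> ((\<exists>l::nat. l \<ge> 1 \<and> int n = 16 * int l - 1) \<longrightarrow>
        is_segment (near_optimal_degrees n)
          ((real n + 9) / 8) ((real n + 7) / 2) ((3 * real n + 19) / 8))
   \<and> ((\<exists>l::nat. l \<ge> 1 \<and> int n = 16 * int l - 9) \<longrightarrow>
        is_segment (near_optimal_degrees n)
          ((real n + 1) / 8) ((real n + 7) / 2) ((3 * real n + 27) / 8))
   \<and> ((\<exists>l::nat. l \<ge> 1 \<and> int n = 16 * int l - 5) \<longrightarrow>
        is_segment (near_optimal_degrees n)
          ((real n + 13) / 8) ((real n + 7) / 2) ((3 * real n + 15) / 8))
   \<and> ((\<exists>l::nat. l \<ge> 1 \<and> int n = 16 * int l - 13) \<longrightarrow>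
        is_segment (near_optimal_degrees n)
          ((real n + 5) / 8) (min ((real n + 7) / 2) (real n))
          (min ((3 * real n + 23) / 8) (real n - 1)))"
proof -
  have "even (n + 1)" using assms(2) by simp
  then obtain m where n2: "n + 1 = 2 * m" by (rule evenE)
  then have m: "n + 1 = 2 * m" "0 < m" by presburger+
  note n = m(1) assms(3)
  have hmin: "h_min n = m div 2 + 1" by (rule h_min_eq[OF n m(2)])
  have near: "near_optimal_degrees n = {d \<in> odd_degrees n. h_min_deg n d \<le> m div 2 + 2}"
    by (simp add: near_optimal_degrees_def hmin)
  note opt = optimal_degrees_eq[of n, unfolded hmin]
  have rn: "real n = 2 * real m - 1" using m by linarith
  \<comment> \<open>In every case \<open>A\<close> is \<open>h / e\<close> rounded up and
    \<open>B\<close> is the smaller of \<open>h\<close> and \<open>m\<close>.\<close>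
  show ?thesis
  proof (intro conjI; intro impI; elim exE conjE)
    fix k :: nat assume "1 \<le> k" "int n = 8 * int k - 3 \<or> int n = 8 * int k - 7"
    \<comment> \<open>Both residue classes amount to odd \<open>m\<close>, where
      \<open>e = 1\<close> leaves only \<open>c = h\<close>.\<close>
    then have "odd m" using m(1) by presburger
    then obtain j where "m = 2 * j + 1" by (rule oddE)
    then show "real (h_min n) = (real n + 3) / 4 \<and>
        is_segment (optimal_degrees n) ((real n + 1) / 2) ((real n + 1) / 2) 0"
      unfolding opt
      by (intro conjI is_segment_degrees_le[OF n, where e = 1 and A = "j + 1" and B = "j + 1"])
        (auto simp: hmin rn)
  next
    fix k :: nat assume k: "1 \<le> k" "int n = 8 * int k - 1"
    then have "m = 4 * k" using m(1) by linarith
    then show "real (h_min n) = (real n + 5) / 4 \<and>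
        is_segment (optimal_degrees n) ((real n + 5) / 4) ((real n + 3) / 2) ((real n + 1) / 4)"
      unfolding opt
      by (intro conjI is_segment_degrees_le[OF n, where e = 2 and A = "k + 1" and B = "2 * k + 1"])
        (use k in \<open>auto simp: hmin rn field_simps\<close>)
  next
    fix k :: nat assume k: "1 \<le> k" "int n = 8 * int k - 5"
    then obtain j where "k = j + 1" using le_Suc_ex[of 1 k] by auto
    then have m: "m = 4 * j + 2" using m(1) k by linarith
    then have h: "m div 2 + 1 = 2 * j + 2" by simp
    show "real (h_min n) = (real n + 5) / 4 \<and>
        is_segment (optimal_degrees n) ((real n + 1) / 4) ((real n + 3) / 2) ((real n + 5) / 4)"
      unfolding opt hmin h
      by (intro conjI is_segment_degrees_le[OF n, where e = 2 and A = "j + 1" and B = "2 * j + 2"])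
        (auto simp: rn m field_simps min_def)
  next
    fix l :: nat assume l: "1 \<le> l" "int n = 12 * int l - 3"
    then obtain j where "l = j + 1" using le_Suc_ex[of 1 l] by auto
    then have m: "m = 6 * j + 5" using m(1) l by linarith
    then have h: "m div 2 + 2 = 3 * j + 4" by simp
    show "is_segment (near_optimal_degrees n) ((real n + 9) / 6) ((real n + 5) / 2) ((real n + 3) / 3)"
      unfolding near h
      by (rule is_segment_degrees_le[OF n, where e = 3 and A = "j + 2" and B = "3 * j + 4"])
        (auto simp: rn m field_simps min_def)
  next
    fix l :: nat assume l: "1 \<le> l" "int n = 12 * int l - 7"
    then obtain j where "l = j + 1" using le_Suc_ex[of 1 l] by auto
    then have m: "m = 6 * j + 3" using m(1) l by linarith
    then have h: "m div 2 + 2 = 3 * j + 3" by simp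
    show "is_segment (near_optimal_degrees n) ((real n + 1) / 6) ((real n + 5) / 2) ((real n + 7) / 3)"
      unfolding near h
      by (rule is_segment_degrees_le[OF n, where e = 3 and A = "j + 1" and B = "3 * j + 3"])
        (auto simp: rn m field_simps min_def)
  next
    fix l :: nat assume l: "1 \<le> l" "int n = 12 * int l - 11"
    then obtain j where "l = j + 1" using le_Suc_ex[of 1 l] by auto
    then have m: "m = 6 * j + 1" using m(1) l by linarith
    then have h: "m div 2 + 2 = 3 * j + 2" by simp
    \<comment> \<open>For \<open>j = 0\<close>, that is \<open>n = 1\<close>, the bound
      \<open>c \<le> m\<close> cuts off the upper end.\<close>
    show "is_segment (near_optimal_degrees n) ((real n + 5) / 6) (min ((real n + 5) / 2) (real n))
          (min ((real n + 5) / 3) (real n - 1))"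
      unfolding near h
      by (cases j; rule is_segment_degrees_le[OF n, where e = 3 and A = "j + 1" and B = "min (3 * j + 2) (6 * j + 1)"];
        auto simp: rn m field_simps min_def)
  next
    fix l :: nat assume l: "1 \<le> l" "int n = 16 * int l - 1"
    then obtain j where "l = j + 1" using le_Suc_ex[of 1 l] by auto
    then have m: "m = 8 * j + 8" using m(1) l by linarith
    then have h: "m div 2 + 2 = 4 * j + 6" by simp
    show "is_segment (near_optimal_degrees n) ((real n + 9) / 8) ((real n + 7) / 2) ((3 * real n + 19) / 8)"
      unfolding near h
      by (rule is_segment_degrees_le[OF n, where e = 4 and A = "j + 2" and B = "4 * j + 6"])
        (auto simp: rn m field_simps min_def)
  next
    fix l :: nat assume l: "1 \<le> l" "int n = 16 * int l - 9"
    then obtain j where "l = j + 1" using le_Suc_ex[of 1 l] by auto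
    then have m: "m = 8 * j + 4" using m(1) l by linarith
    then have h: "m div 2 + 2 = 4 * j + 4" by simp
    show "is_segment (near_optimal_degrees n) ((real n + 1) / 8) ((real n + 7) / 2) ((3 * real n + 27) / 8)"
      unfolding near h
      by (rule is_segment_degrees_le[OF n, where e = 4 and A = "j + 1" and B = "4 * j + 4"])
        (auto simp: rn m field_simps min_def)
  next
    fix l :: nat assume l: "1 \<le> l" "int n = 16 * int l - 5"
    then obtain j where "l = j + 1" using le_Suc_ex[of 1 l] by auto
    then have m: "m = 8 * j + 6" using m(1) l by linarith
    then have h: "m div 2 + 2 = 4 * j + 5" by simp
    show "is_segment (near_optimal_degrees n) ((real n + 13) / 8) ((real n + 7) / 2) ((3 * real n + 15) / 8)"
      unfolding near h
      by (rule is_segment_degrees_le[OF n, where e = 4 and A = "j + 2" and B = "4 * j + 5"])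
        (auto simp: rn m field_simps min_def)
  next
    fix l :: nat assume l: "1 \<le> l" "int n = 16 * int l - 13"
    then obtain j where "l = j + 1" using le_Suc_ex[of 1 l] by auto
    then have m: "m = 8 * j + 2" using m(1) l by linarith
    then have h: "m div 2 + 2 = 4 * j + 3" by simp
    \<comment> \<open>Here the cut by \<open>m\<close> occurs for \<open>n = 3\<close>.\<close>
    show "is_segment (near_optimal_degrees n) ((real n + 5) / 8) (min ((real n + 7) / 2) (real n))
          (min ((3 * real n + 23) / 8) (real n - 1))"
      unfolding near h
      by (cases j; rule is_segment_degrees_le[OF n, where e = 4 and A = "j + 1" and B = "min (4 * j + 3) (8 * j + 2)"];
        auto simp: rn m field_simps min_def)
  qed
qed

end
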